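(* Let $I$ be a subset of $\mathbb{R}$ containing at least two points, let $\mathscr{D}=I^2$, and let $M_1,M_2$ be two mean functions on $\mathscr{D}$ with values in $I$ such that $\mathrm{d}(M_1,M_2)<1$. Then there exists a unique mean function $M$ on $\mathscr{D}$ satisfying $M(M_1(x,y),M_2(x,y))=M(x,y)$ for all $(x,y)\in\mathscr{D}$. Moreover, for every $(x,y)\in\mathscr{D}$, $M(x,y)$ is the common limit of the real sequences $(x_n)_n,(y_n)_n$ defined by $x_0=x$, $y_0=y$, $x_{n+1}=M_1(x_n,y_n)$, $y_{n+1}=M_2(x_n,y_n)$ for all $n\in\mathbb{N}$.
   Context: A mean function on a set $\mathscr{D}\subseteq\mathbb{R}^2$ with $(x,y)\in\mathscr{D}\Rightarrow(y,x)\in\mathscr{D}$ is a function $M:\mathscr{D}\to\mathbb{R}$ such that: (i) $M(x,y)=M(y,x)$; (ii) $\min(x,y)\le M(x,y)\le\max(x,y)$; (iii) $M(x,y)=x$ implies $x=y$ (all for $(x,y)\in\mathscr{D}$). For $\mathscr{D}$ containing some point $(x_0,y_0)$ with $x_0\ne y_0$ and mean functions $M_1,M_2$ on $\mathscr{D}$, define $\mathrm{d}(M_1,M_2):=\sup_{(x,y)\in\mathscr{D},\,x\neq y}\left|\frac{M_1(x,y)-M_2(x,y)}{x-y}\right|$. *)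

theory Defs
  imports Complex_Main "HOL-Library.FuncSet"
begin

text \<open>Only the values of a mean function on its domain are constrained; functions that
  agree on the domain represent the same mean function.\<close>

definition mean_function :: "(real \<times> real) set \<Rightarrow> (real \<times> real \<Rightarrow> real) \<Rightarrow> bool" where
  "mean_function D M \<longleftrightarrow> sym D \<and>
     (\<forall>(x, y) \<in> D. M (x, y) = M (y, x) \<and>
        min x y \<le> M (x, y) \<and> M (x, y) \<le> max x y \<and>
        (M (x, y) = x \<longrightarrow> x = y))"

text \<open>For mean functions both values lie between \<open>x\<close> and \<open>y\<close>, so the quotients are bounded
  by 1; the supremum in the reals is thus meaningful as soon as \<open>D\<close> has an off-diagonal point.\<close>

definition mean_dist ::
  "(real \<times> real) set \<Rightarrow> (real \<times> real \<Rightarrow> real) \<Rightarrow> (real \<times> real \<Rightarrow> real) \<Rightarrow> real" where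
  "mean_dist D M1 M2 =
     (SUP (x, y) \<in> {(x, y). (x, y) \<in> D \<and> x \<noteq> y}. \<bar>(M1 (x, y) - M2 (x, y)) / (x - y)\<bar>)"

primrec mean_iter ::
  "(real \<times> real \<Rightarrow> real) \<Rightarrow> (real \<times> real \<Rightarrow> real) \<Rightarrow> real \<times> real \<Rightarrow> nat \<Rightarrow> real \<times> real" where
  "mean_iter M1 M2 p 0 = p"
| "mean_iter M1 M2 p (Suc n) = (M1 (mean_iter M1 M2 p n), M2 (mean_iter M1 M2 p n))"

end

theory Submission
  imports Defs
begin

text \<open>Write \<open>k < 1\<close> for the distance of the two means. One step of the iteration shrinks
  \<open>\<bar>x - y\<bar>\<close> by the factor \<open>k\<close>, and the intervals between \<open>x\<^sub>n\<close> and \<open>y\<^sub>n\<close> are nested, so they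
  shrink to a point \<open>L (x, y)\<close>. Discarding the first step leaves \<open>L\<close> unchanged, which is
  invariance. Strictness holds because, for \<open>x \<noteq> y\<close>, the first step already moves both endpoints
  away from \<open>x\<close>. Conversely, an invariant mean \<open>M\<close> satisfies \<open>M (x, y) = M (x\<^sub>n, y\<^sub>n)\<close>, so its value
  lies in all the intervals.\<close>

lemma mean_functionD:
  assumes "mean_function D M" and "(x, y) \<in> D"
  shows "M (x, y) = M (y, x)" and "min x y \<le> M (x, y)" and "M (x, y) \<le> max x y"
    and "M (x, y) = x \<Longrightarrow> x = y"
  using assms unfolding mean_function_def by blast+

text \<open>The axiom only excludes the first argument as a value. Applied at \<open>(y, x)\<close>,
  which lies in the symmetric domain, it excludes the second one too.\<close>

lemma mean_function_neq:
  assumes "mean_function D M" and "(x, y) \<in> D" and "x \<noteq> y"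
  shows "M (x, y) \<noteq> x" and "M (x, y) \<noteq> y"
proof -
  have "(y, x) \<in> D"
    using assms unfolding mean_function_def sym_def by blast
  then show "M (x, y) \<noteq> x" "M (x, y) \<noteq> y"
    using assms mean_functionD(1,4) by metis+
qed

text \<open>The recursion adds a step at the end; this form splits off the first step, as needed to
  compare the iterations started at \<open>p\<close> and at its image.\<close>

lemma mean_iter_shift:
  "mean_iter M1 M2 p (Suc n) = mean_iter M1 M2 (M1 p, M2 p) n"
  by (induction n) auto

lemma abs_diff_le_mean_dist:
  assumes "mean_function D M1" and "mean_function D M2" and "(x, y) \<in> D"
  shows "\<bar>M1 (x, y) - M2 (x, y)\<bar> \<le> mean_dist D M1 M2 * \<bar>x - y\<bar>"
proof (cases "x = y")
  case True
  then show ?thesis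
    using mean_functionD(2,3)[OF assms(1,3)] mean_functionD(2,3)[OF assms(2,3)] by auto
next
  case False
  let ?S = "{(x, y). (x, y) \<in> D \<and> x \<noteq> y}"
  let ?f = "\<lambda>(x, y). \<bar>(M1 (x, y) - M2 (x, y)) / (x - y)\<bar>"
  \<comment> \<open>A real supremum dominates its members only if the set is bounded. Two values
    between \<open>u\<close> and \<open>v\<close> differ by at most
    \<open>\<bar>u - v\<bar>\<close>, so 1 is a bound.\<close>
  have "bdd_above (?f ` ?S)"
  proof (rule bdd_aboveI2[where M = 1], clarify)
    fix u v :: real
    assume "(u, v) \<in> D" and "u \<noteq> v"
    then have "\<bar>M1 (u, v) - M2 (u, v)\<bar> \<le> \<bar>u - v\<bar>"
      using mean_functionD(2,3)[OF assms(1)] mean_functionD(2,3)[OF assms(2)] by (smt (verit))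
    then show "\<bar>(M1 (u, v) - M2 (u, v)) / (u - v)\<bar> \<le> 1"
      using \<open>u \<noteq> v\<close> by (simp add: abs_divide divide_le_eq)
  qed
  then have "?f (x, y) \<le> mean_dist D M1 M2"
    unfolding mean_dist_def using assms(3) False by (intro cSUP_upper) auto
  then show ?thesis
    using False by (simp add: abs_divide divide_le_eq)
qed

locale contracting_mean_pair =
  fixes I :: "real set" and M1 M2 :: "real \<times> real \<Rightarrow> real"
  assumes nontrivial: "\<exists>a\<in>I. \<exists>b\<in>I. a \<noteq> b"
    and mean1: "mean_function (I \<times> I) M1" and mean2: "mean_function (I \<times> I) M2"
    and range1: "M1 \<in> I \<times> I \<rightarrow> I" and range2: "M2 \<in> I \<times> I \<rightarrow> I"
    and dist_less_1: "mean_dist (I \<times> I) M1 M2 < 1"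
begin

text \<open>An abbreviation, so that facts about it match the theorem's statement without
  unfolding.\<close>

abbreviation invariant_mean :: "(real \<times> real \<Rightarrow> real) \<Rightarrow> bool" where
  "invariant_mean M \<equiv> mean_function (I \<times> I) M \<and>
     (\<forall>(x, y) \<in> I \<times> I. M (M1 (x, y), M2 (x, y)) = M (x, y))"

abbreviation iter1 :: "real \<times> real \<Rightarrow> nat \<Rightarrow> real" where
  "iter1 p n \<equiv> fst (mean_iter M1 M2 p n)"

abbreviation iter2 :: "real \<times> real \<Rightarrow> nat \<Rightarrow> real" where
  "iter2 p n \<equiv> snd (mean_iter M1 M2 p n)"

lemma step_in: "p \<in> I \<times> I \<Longrightarrow> (M1 p, M2 p) \<in> I \<times> I"
  using range1 range2 by blast

lemma iter_in: "p \<in> I \<times> I \<Longrightarrow> mean_iter M1 M2 p n \<in> I \<times> I"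
  by (induction n) (use step_in in auto)

lemma iter_in': "p \<in> I \<times> I \<Longrightarrow> (iter1 p n, iter2 p n) \<in> I \<times> I"
  using iter_in by simp

text \<open>At an off-diagonal point, the factor \<open>\<bar>a - b\<bar>\<close> is positive and
  can be cancelled.\<close>

lemma mean_dist_nonneg: "0 \<le> mean_dist (I \<times> I) M1 M2"
proof -
  obtain a b where "(a, b) \<in> I \<times> I" and "a \<noteq> b"
    using nontrivial by blast
  then have "0 \<le> mean_dist (I \<times> I) M1 M2 * \<bar>a - b\<bar>"
    using abs_diff_le_mean_dist[OF mean1 mean2] by (meson abs_ge_zero order_trans)
  then show ?thesis
    using \<open>a \<noteq> b\<close> by (simp add: zero_le_mult_iff)
qed

lemma iter_diff_bound:
  assumes "p \<in> I \<times> I"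
  shows "\<bar>iter1 p n - iter2 p n\<bar> \<le> mean_dist (I \<times> I) M1 M2 ^ n * \<bar>fst p - snd p\<bar>"
proof (induction n)
  case 0
  then show ?case by simp
next
  case (Suc n)
  have "\<bar>iter1 p (Suc n) - iter2 p (Suc n)\<bar>
      \<le> mean_dist (I \<times> I) M1 M2 * \<bar>iter1 p n - iter2 p n\<bar>"
    using abs_diff_le_mean_dist[OF mean1 mean2 iter_in'[OF assms]] by simp
  also have "\<dots> \<le> mean_dist (I \<times> I) M1 M2 *
      (mean_dist (I \<times> I) M1 M2 ^ n * \<bar>fst p - snd p\<bar>)"
    using Suc mean_dist_nonneg by (rule mult_left_mono)
  finally show ?case by (simp add: mult.assoc)
qed

text \<open>Nested intervals whose lengths tend to 0 have exactly one common point. The last clause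
  will identify that point with the value of any invariant mean.\<close>

lemma iter_limit:
  assumes "p \<in> I \<times> I"
  obtains l where "iter1 p \<longlonglongrightarrow> l" and "iter2 p \<longlonglongrightarrow> l"
    and "\<And>n. min (iter1 p n) (iter2 p n) \<le> l" and "\<And>n. l \<le> max (iter1 p n) (iter2 p n)"
    and "\<forall>c. (\<forall>n. min (iter1 p n) (iter2 p n) \<le> c \<and> c \<le> max (iter1 p n) (iter2 p n)) \<longrightarrow> c = l"
proof -
  \<comment> \<open>The iterates may change their order from step to step, so neither sequence need
    be monotone; the sorted endpoints are.\<close>
  define u v where "u = (\<lambda>n. min (iter1 p n) (iter2 p n))" and "v = (\<lambda>n. max (iter1 p n) (iter2 p n))"
  have step: "u n \<le> u (Suc n) \<and> v (Suc n) \<le> v n" for n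
    using mean_functionD(2,3)[OF mean1 iter_in'[OF assms, of n]]
      mean_functionD(2,3)[OF mean2 iter_in'[OF assms, of n]]
    by (simp add: u_def v_def)
  have "(\<lambda>n. mean_dist (I \<times> I) M1 M2 ^ n * \<bar>fst p - snd p\<bar>) \<longlonglongrightarrow> 0"
    using mean_dist_nonneg dist_less_1 by (intro tendsto_mult_left_zero LIMSEQ_realpow_zero)
  then have "(\<lambda>n. u n - v n) \<longlonglongrightarrow> 0"
  proof (rule tendsto_0_le[where K = 1])
    have "norm (u n - v n) \<le> norm (mean_dist (I \<times> I) M1 M2 ^ n * \<bar>fst p - snd p\<bar>) * 1" for n
    proof -
      have "norm (u n - v n) = \<bar>iter1 p n - iter2 p n\<bar>"
        by (simp add: u_def v_def)
      also have "\<dots> \<le> mean_dist (I \<times> I) M1 M2 ^ n * \<bar>fst p - snd p\<bar>"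
        using iter_diff_bound[OF assms] .
      finally show ?thesis by simp
    qed
    then show "\<forall>\<^sub>F n in sequentially. norm (u n - v n)
        \<le> norm (mean_dist (I \<times> I) M1 M2 ^ n * \<bar>fst p - snd p\<bar>) * 1"
      by (rule always_eventually[OF allI])
  qed
  moreover have "u n \<le> v n" for n
    by (simp add: u_def v_def)
  ultimately obtain l where l: "\<And>n. u n \<le> l" "u \<longlonglongrightarrow> l" "\<And>n. l \<le> v n" "v \<longlonglongrightarrow> l"
    using nested_sequence_unique[of u v] step by blast
  have "iter1 p \<longlonglongrightarrow> l" "iter2 p \<longlonglongrightarrow> l"
    by (rule tendsto_sandwich[OF _ _ l(2) l(4)]; simp add: u_def v_def)+
  moreover have "\<forall>c. (\<forall>n. u n \<le> c \<and> c \<le> v n) \<longrightarrow> c = l"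
    using l(2,4) by (meson LIMSEQ_le_const LIMSEQ_le_const2 antisym)
  ultimately show thesis
    using l(1,3) unfolding u_def v_def by (intro that)
qed

lemma invariant_mean_iter:
  assumes "invariant_mean M" and "p \<in> I \<times> I"
  shows "M (mean_iter M1 M2 p n) = M p"
proof (induction n)
  case (Suc n)
  then show ?case
    using assms(1) iter_in[OF assms(2), of n] by (cases "mean_iter M1 M2 p n") auto
qed simp

text \<open>By invariance \<open>M p\<close> is also the value of \<open>M\<close> at the n-th
  iterate, hence lies in the n-th interval, for every n. Only one point does.\<close>

lemma invariant_mean_limit:
  assumes "invariant_mean M" and "p \<in> I \<times> I"
  shows "iter1 p \<longlonglongrightarrow> M p" and "iter2 p \<longlonglongrightarrow> M p"
proof -
  have "min (iter1 p n) (iter2 p n) \<le> M p \<and> M p \<le> max (iter1 p n) (iter2 p n)" for n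
    using mean_functionD(2,3)[of "I \<times> I" M, OF _ iter_in'[OF assms(2), of n]] assms(1)
      invariant_mean_iter[OF assms] by simp
  moreover obtain l where "iter1 p \<longlonglongrightarrow> l" "iter2 p \<longlonglongrightarrow> l"
    and "\<forall>c. (\<forall>n. min (iter1 p n) (iter2 p n) \<le> c \<and> c \<le> max (iter1 p n) (iter2 p n)) \<longrightarrow> c = l"
    by (rule iter_limit[OF assms(2)]) (rule that)
  ultimately have "M p = l"
    by blast
  then show "iter1 p \<longlonglongrightarrow> M p" "iter2 p \<longlonglongrightarrow> M p"
    using \<open>iter1 p \<longlonglongrightarrow> l\<close> \<open>iter2 p \<longlonglongrightarrow> l\<close> by simp_all
qed

text \<open>Restricted to \<open>I \<times> I\<close> because uniqueness is stated among extensional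
  functions. Either sequence could serve, as their limits agree.\<close>

definition limit_mean :: "real \<times> real \<Rightarrow> real" where
  "limit_mean = (\<lambda>p \<in> I \<times> I. lim (iter1 p))"

lemma limit_mean_bounds:
  assumes "p \<in> I \<times> I"
  shows "min (iter1 p n) (iter2 p n) \<le> limit_mean p"
    and "limit_mean p \<le> max (iter1 p n) (iter2 p n)"
proof -
  obtain l where "iter1 p \<longlonglongrightarrow> l"
    and l: "min (iter1 p n) (iter2 p n) \<le> l" "l \<le> max (iter1 p n) (iter2 p n)"
    by (rule iter_limit[OF assms]) (rule that)
  then have "limit_mean p = l"
    using assms by (simp add: limit_mean_def limI)
  then show "min (iter1 p n) (iter2 p n) \<le> limit_mean p"
    and "limit_mean p \<le> max (iter1 p n) (iter2 p n)"
    using l by simp_all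
qed

lemma limit_mean_step:
  assumes "p \<in> I \<times> I"
  shows "limit_mean (M1 p, M2 p) = limit_mean p"
proof -
  obtain l where "iter1 p \<longlonglongrightarrow> l"
    by (rule iter_limit[OF assms]) (rule that)
  moreover from this have "iter1 (M1 p, M2 p) \<longlonglongrightarrow> l"
    using LIMSEQ_Suc[of "iter1 p" l] by (simp only: mean_iter_shift)
  ultimately show ?thesis
    using assms step_in[OF assms] by (simp add: limit_mean_def limI)
qed

lemma limit_mean_invariant: "invariant_mean limit_mean"
proof
  show "mean_function (I \<times> I) limit_mean"
    unfolding mean_function_def
  proof (intro conjI ballI, goal_cases)
    case 1
    show ?case by (simp add: sym_def)
  next
    case (2 p)
    obtain x y where p: "p = (x, y)" by (cases p)
    with 2 have D: "(x, y) \<in> I \<times> I" "(y, x) \<in> I \<times> I" by auto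
    \<comment> \<open>Swapped arguments have the same image after one step, so symmetry of the limit
      follows from its invariance.\<close>
    have "(M1 (x, y), M2 (x, y)) = (M1 (y, x), M2 (y, x))"
      using mean_functionD(1)[OF mean1 D(1)] mean_functionD(1)[OF mean2 D(1)] by simp
    then have "limit_mean (x, y) = limit_mean (y, x)"
      using limit_mean_step D by metis
    \<comment> \<open>The interval for n = 1 has the endpoints \<open>M1 (x, y)\<close> and
      \<open>M2 (x, y)\<close>, both strictly between \<open>x\<close> and \<open>y\<close>. The
      interval for n = 0 would still contain \<open>x\<close>.\<close>
    moreover have "limit_mean (x, y) \<noteq> x" if "x \<noteq> y"
      using limit_mean_bounds[OF D(1), of 1] that
        mean_functionD(2,3)[OF mean1 D(1)] mean_function_neq[OF mean1 D(1)]
        mean_functionD(2,3)[OF mean2 D(1)] mean_function_neq[OF mean2 D(1)]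
      by simp
    ultimately show ?case
      using limit_mean_bounds[OF D(1), of 0] by (auto simp: p)
  qed
qed (use limit_mean_step in auto)

end

theorem theorem2:
  fixes I :: "real set" and M1 M2 :: "real \<times> real \<Rightarrow> real"
  assumes "\<exists>a\<in>I. \<exists>b\<in>I. a \<noteq> b"
    and "mean_function (I \<times> I) M1" and "mean_function (I \<times> I) M2"
    and "M1 \<in> I \<times> I \<rightarrow> I" and "M2 \<in> I \<times> I \<rightarrow> I"
    and "mean_dist (I \<times> I) M1 M2 < 1"
  shows "(\<exists>!M. M \<in> extensional (I \<times> I) \<and> mean_function (I \<times> I) M \<and>
             (\<forall>(x, y) \<in> I \<times> I. M (M1 (x, y), M2 (x, y)) = M (x, y))) \<and>
         (\<forall>M. mean_function (I \<times> I) M \<and>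
             (\<forall>(x, y) \<in> I \<times> I. M (M1 (x, y), M2 (x, y)) = M (x, y)) \<longrightarrow>
             (\<forall>(x, y) \<in> I \<times> I.
                (\<lambda>n. fst (mean_iter M1 M2 (x, y) n)) \<longlonglongrightarrow> M (x, y) \<and>
                (\<lambda>n. snd (mean_iter M1 M2 (x, y) n)) \<longlonglongrightarrow> M (x, y)))"
proof -
  interpret contracting_mean_pair I M1 M2
    using assms by unfold_locales
  have "M = limit_mean" if "M \<in> extensional (I \<times> I)" and "invariant_mean M" for M
  proof (rule extensionalityI[of _ "I \<times> I"])
    show "limit_mean \<in> extensional (I \<times> I)"
      by (simp add: limit_mean_def)
    \<comment> \<open>Both values are limits of the same sequence \<open>iter1 p\<close>.\<close>
    show "M p = limit_mean p" if "p \<in> I \<times> I" for p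
      using invariant_mean_limit(1)[OF \<open>invariant_mean M\<close> that]
        invariant_mean_limit(1)[OF limit_mean_invariant that] by (rule LIMSEQ_unique)
  qed (rule that(1))
  moreover have "limit_mean \<in> extensional (I \<times> I)"
    by (simp add: limit_mean_def)
  ultimately have "\<exists>!M. M \<in> extensional (I \<times> I) \<and> invariant_mean M"
    using limit_mean_invariant by blast
  then show ?thesis
    using invariant_mean_limit by blast
qed

end
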